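(* The category $\mathsf{FinPf}$ of finiteness spaces and finitary partial functions, equipped with the tensor product $\otimes$ and unit $I$ given in the context, is a symmetric monoidal closed category.
   Context: For a set $X$ and a collection $\mathcal{U}\subseteq\mathcal{P}(X)$ of subsets, put $\mathcal{U}^\perp=\{u'\subseteq X \mid u'\cap u \text{ is finite for all } u\in\mathcal{U}\}$. A finiteness space is a pair $(X,\mathcal{U})$ with $X$ a set and $\mathcal{U}\subseteq\mathcal{P}(X)$ such that $\mathcal{U}^{\perp\perp}=\mathcal{U}$. The category $\mathsf{FinPf}$ has finiteness spaces as objects. A morphism $f\colon (X,\mathcal{U})\to(Y,\mathcal{V})$ is a partial function $f\colon X\to Y$ such that (1) for all $u\in\mathcal{U}$, the image $f(u)=\{f(x)\mid x\in u,\ f(x)\text{ defined}\}$ is in $\mathcal{V}$; and (2) for all $v'\in\mathcal{V}^\perp$, the preimage $f^{-1}(v')=\{x\in X\mid f(x)\text{ is defined and } f(x)\in v'\}$ is in $\mathcal{U}^\perp$. Composition and identities are those of partial functions. The tensor product is $(X,\mathcal{U})\otimes(Y,\mathcal{V})=(X\times Y,\mathcal{W})$ with $\mathcal{W}=\{u\times v\mid u\in\mathcal{U},v\in\mathcal{V}\}^{\perp\perp}=\{w\mid \exists u\in\mathcal{U},\exists v\in\mathcal{V},\ w\subseteq u\times v\}$; on morphisms, $(f\otimes g)(x,y)=(f(x),g(y))$, defined exactly when both $f(x)$ and $g(y)$ are defined. The unit is $I=(\{*\},\mathcal{P}(\{*\}))$, and the associativity, unit and symmetry isomorphisms are the usual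 ones for the cartesian product of sets. Closed means that for each object $\mathbb{X}$ the functor $-\otimes\mathbb{X}$ has a right adjoint. *)

theory Defs
  imports Main
begin

text \<open>
  A HOL set lives in a type, and no HOL type can be shown to contain an infinite set together with
  all its iterated function spaces.  The large category of finiteness spaces is therefore rendered
  polymorphically: its objects are the finiteness spaces over all types, and an arrow may go from a
  space over one type to a space over another.
\<close>

record 'a fspace =
  pts :: "'a set"
  fam :: "'a set set"

definition orth :: "'a set \<Rightarrow> 'a set set \<Rightarrow> 'a set set" where
  "orth X U = {u'. u' \<subseteq> X \<and> (\<forall>u\<in>U. finite (u' \<inter> u))}"

definition FinSp :: "'a fspace set" where
  "FinSp = {S. fam S \<subseteq> Pow (pts S) \<and> orth (pts S) (orth (pts S) (fam S)) = fam S}"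

definition pimage :: "('a \<rightharpoonup> 'b) \<Rightarrow> 'a set \<Rightarrow> 'b set" where
  "pimage f u = {y. \<exists>x\<in>u. f x = Some y}"

definition ppreimage :: "('a \<rightharpoonup> 'b) \<Rightarrow> 'b set \<Rightarrow> 'a set" where
  "ppreimage f v = {x. \<exists>y\<in>v. f x = Some y}"

text \<open>
  A partial function between carriers is a map that is \<open>None\<close> off its source carrier, so that
  equality of maps is equality of arrows.  Composition is \<^const>\<open>map_comp\<close>.
\<close>

definition Hom :: "'a fspace \<Rightarrow> 'b fspace \<Rightarrow> ('a \<rightharpoonup> 'b) set" where
  "Hom S T = {f. dom f \<subseteq> pts S \<and> ran f \<subseteq> pts T \<and>
     (\<forall>u\<in>fam S. pimage f u \<in> fam T) \<and>
     (\<forall>v'\<in>orth (pts T) (fam T). ppreimage f v' \<in> orth (pts S) (fam S))}"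

definition ident :: "'a fspace \<Rightarrow> ('a \<rightharpoonup> 'a)" where
  "ident S = Some |` pts S"

definition Iso :: "'a fspace \<Rightarrow> 'b fspace \<Rightarrow> ('a \<rightharpoonup> 'b) set" where
  "Iso S T = {f \<in> Hom S T. \<exists>g\<in>Hom T S. g \<circ>\<^sub>m f = ident S \<and> f \<circ>\<^sub>m g = ident T}"


subsection \<open>Tensor product\<close>

definition tensor :: "'a fspace \<Rightarrow> 'b fspace \<Rightarrow> ('a \<times> 'b) fspace" (infixr "\<otimes>" 75) where
  "S \<otimes> T = \<lparr>pts = pts S \<times> pts T,
     fam = orth (pts S \<times> pts T) (orth (pts S \<times> pts T) {u \<times> v | u v. u \<in> fam S \<and> v \<in> fam T})\<rparr>"

definition tensor_map :: "('a \<rightharpoonup> 'c) \<Rightarrow> ('b \<rightharpoonup> 'd) \<Rightarrow> ('a \<times> 'b \<rightharpoonup> 'c \<times> 'd)" (infixr "\<otimes>\<^sub>m" 75) where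
  "f \<otimes>\<^sub>m g = (\<lambda>(x, y). case (f x, g y) of (Some a, Some b) \<Rightarrow> Some (a, b) | _ \<Rightarrow> None)"

definition unit_sp :: "unit fspace" where
  "unit_sp = \<lparr>pts = {()}, fam = Pow {()}\<rparr>"

definition assoc :: "'a fspace \<Rightarrow> 'b fspace \<Rightarrow> 'c fspace \<Rightarrow> (('a \<times> 'b) \<times> 'c \<rightharpoonup> 'a \<times> 'b \<times> 'c)" where
  "assoc A B C = (\<lambda>((a, b), c). Some (a, b, c)) |` pts ((A \<otimes> B) \<otimes> C)"

definition lunit :: "'a fspace \<Rightarrow> (unit \<times> 'a \<rightharpoonup> 'a)" where
  "lunit A = (\<lambda>(_, a). Some a) |` pts (unit_sp \<otimes> A)"

definition runit :: "'a fspace \<Rightarrow> ('a \<times> unit \<rightharpoonup> 'a)" where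
  "runit A = (\<lambda>(a, _). Some a) |` pts (A \<otimes> unit_sp)"

definition symm :: "'a fspace \<Rightarrow> 'b fspace \<Rightarrow> ('a \<times> 'b \<rightharpoonup> 'b \<times> 'a)" where
  "symm A B = (\<lambda>(a, b). Some (b, a)) |` pts (A \<otimes> B)"

text \<open>The two descriptions of the finiteness structure of a tensor product agree.\<close>

lemma fam_tensor:
  assumes S: "S \<in> FinSp" and T: "T \<in> FinSp"
  shows "fam (S \<otimes> T) = {w. \<exists>u\<in>fam S. \<exists>v\<in>fam T. w \<subseteq> u \<times> v}"
proof -
  let ?R = "{u \<times> v | u v. u \<in> fam S \<and> v \<in> fam T}"
  let ?P = "pts S \<times> pts T"
  have S1: "u \<subseteq> pts S" if "u \<in> fam S" for u using S that by (auto simp: FinSp_def)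
  have T1: "v \<subseteq> pts T" if "v \<in> fam T" for v using T that by (auto simp: FinSp_def)
  have S2: "u \<in> fam S" if "u \<subseteq> pts S" "\<And>u'. u' \<in> orth (pts S) (fam S) \<Longrightarrow> finite (u \<inter> u')" for u
    using S that by (auto simp: FinSp_def orth_def)
  have T2: "v \<in> fam T" if "v \<subseteq> pts T" "\<And>v'. v' \<in> orth (pts T) (fam T) \<Longrightarrow> finite (v \<inter> v')" for v
    using T that by (auto simp: FinSp_def orth_def)
  have "\<exists>u\<in>fam S. \<exists>v\<in>fam T. w \<subseteq> u \<times> v" if w: "w \<in> orth ?P (orth ?P ?R)" for w
  proof -
    have wP: "w \<subseteq> ?P" and fin: "\<And>w'. w' \<in> orth ?P ?R \<Longrightarrow> finite (w \<inter> w')"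
      using w by (auto simp: orth_def)
    have "fst ` w \<in> fam S"
    proof (rule S2)
      show "fst ` w \<subseteq> pts S" using wP by auto
      fix u' assume u': "u' \<in> orth (pts S) (fam S)"
      define y where "y x = (SOME y. (x, y) \<in> w)" for x
      have y: "(x, y x) \<in> w" if "x \<in> fst ` w" for x
        using that unfolding y_def by (auto intro: someI)
      define w' where "w' = (\<lambda>x. (x, y x)) ` (fst ` w \<inter> u')"
      have "w' \<inter> (u \<times> v) \<subseteq> (\<lambda>x. (x, y x)) ` (u' \<inter> u)" for u v by (auto simp: w'_def)
      moreover have "finite (u' \<inter> u)" if "u \<in> fam S" for u using u' that by (auto simp: orth_def)
      ultimately have "finite (w' \<inter> (u \<times> v))" if "u \<in> fam S" for u v
        using that by (meson finite_imageI finite_subset)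
      moreover have ww: "w' \<subseteq> w" using y by (auto simp: w'_def)
      ultimately have "w' \<in> orth ?P ?R" using wP by (auto simp: orth_def)
      then have "finite (w \<inter> w')" by (rule fin)
      then have "finite w'" using ww by (simp add: inf.absorb2)
      then have "finite (fst ` w')" by simp
      moreover have "fst ` w' = fst ` w \<inter> u'" by (simp add: w'_def image_image)
      ultimately show "finite (fst ` w \<inter> u')" by simp
    qed
    moreover have "snd ` w \<in> fam T"
    proof (rule T2)
      show "snd ` w \<subseteq> pts T" using wP by auto
      fix v' assume v': "v' \<in> orth (pts T) (fam T)"
      define x where "x y = (SOME x. (x, y) \<in> w)" for y
      have x: "(x y, y) \<in> w" if "y \<in> snd ` w" for y
        using that unfolding x_def by (auto intro: someI)
      define w' where "w' = (\<lambda>y. (x y, y)) ` (snd ` w \<inter> v')"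
      have "w' \<inter> (u \<times> v) \<subseteq> (\<lambda>y. (x y, y)) ` (v' \<inter> v)" for u v by (auto simp: w'_def)
      moreover have "finite (v' \<inter> v)" if "v \<in> fam T" for v using v' that by (auto simp: orth_def)
      ultimately have "finite (w' \<inter> (u \<times> v))" if "v \<in> fam T" for u v
        using that by (meson finite_imageI finite_subset)
      moreover have ww: "w' \<subseteq> w" using x by (auto simp: w'_def)
      ultimately have "w' \<in> orth ?P ?R" using wP by (auto simp: orth_def)
      then have "finite (w \<inter> w')" by (rule fin)
      then have "finite w'" using ww by (simp add: inf.absorb2)
      then have "finite (snd ` w')" by simp
      moreover have "snd ` w' = snd ` w \<inter> v'" by (simp add: w'_def image_image)
      ultimately show "finite (snd ` w \<inter> v')" by simp
    qed
    moreover have "w \<subseteq> fst ` w \<times> snd ` w" by force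
    ultimately show ?thesis by blast
  qed
  moreover have "w \<in> orth ?P (orth ?P ?R)"
    if uv: "u \<in> fam S" "v \<in> fam T" "w \<subseteq> u \<times> v" for w u v
  proof -
    have "finite (w \<inter> w')" if "w' \<in> orth ?P ?R" for w'
    proof -
      have "finite (w' \<inter> (u \<times> v))" using that uv unfolding orth_def by blast
      then show ?thesis by (rule rev_finite_subset) (use uv in auto)
    qed
    moreover have "w \<subseteq> ?P" using uv S1[of u] T1[of v] by auto
    ultimately show ?thesis by (auto simp: orth_def)
  qed
  ultimately show ?thesis by (auto simp: tensor_def)
qed


subsection \<open>The right adjoint of tensoring\<close>

text \<open>
  The right adjoint of tensoring with \<open>X\<close> has to be named rather than asserted to exist: an
  existential quantifier could not range outside the quantification over the types of the other
  objects.  Since \<open>Hom unit_sp (ihom X Y)\<close> must correspond to \<open>Hom X Y\<close>, with the empty map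
  matching the empty map, the points of \<open>ihom X Y\<close> are the nonempty arrows.
\<close>

definition ihom :: "'x fspace \<Rightarrow> 'y fspace \<Rightarrow> ('x \<rightharpoonup> 'y) fspace" where
  "ihom X Y = (let H = Hom X Y - {Map.empty} in
     \<lparr>pts = H,
      fam = orth H {{h \<in> H. pimage h u \<inter> v' \<noteq> {}} | u v'. u \<in> fam X \<and> v' \<in> orth (pts Y) (fam Y)}\<rparr>)"

definition ihom_map :: "'x fspace \<Rightarrow> 'y fspace \<Rightarrow> ('y \<rightharpoonup> 'z) \<Rightarrow> (('x \<rightharpoonup> 'y) \<rightharpoonup> ('x \<rightharpoonup> 'z))" where
  "ihom_map X Y k =
     (\<lambda>h. if k \<circ>\<^sub>m h = Map.empty then None else Some (k \<circ>\<^sub>m h)) |` pts (ihom X Y)"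

definition pcurry :: "('z \<times> 'x \<rightharpoonup> 'y) \<Rightarrow> ('z \<rightharpoonup> ('x \<rightharpoonup> 'y))" where
  "pcurry f = (\<lambda>z. let h = (\<lambda>x. f (z, x)) in if h = Map.empty then None else Some h)"

end

theory Submission
  imports Defs
begin

text \<open>
  A partial map carrying \<open>\<U>\<close> into \<open>\<V>\<close> is finitary as soon as it has finite fibres on every member of
  \<open>\<U>\<close>: a member of \<open>\<V>\<^sup>\<bottom>\<close> meets the image of \<open>u \<in> \<U>\<close> in finitely many points, and each of them has
  finitely many preimages in \<open>u\<close>.  With this criterion \<open>\<V>\<^sup>\<bottom>\<close> disappears from most arguments, which
  matters for \<open>ihom X Y\<close>, where \<open>\<V>\<^sup>\<bottom>\<close> is only known through generators.  For the adjunction, \<open>f\<close> on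
  \<open>Z \<otimes> X\<close> is finitary iff \<open>f\<^sup>-\<^sup>1(v') \<inter> (w \<times> u)\<close> is finite for all \<open>w\<close>, \<open>u\<close> and \<open>v'\<close>; its
  projection to \<open>w\<close> is the preimage of a generator under the transpose, and its sections are
  preimages under the single arrows \<open>f(z, -)\<close>.
\<close>

section \<open>Finiteness spaces and finitary maps\<close>

lemma singleton_in_orth: "x \<in> X \<Longrightarrow> {x} \<in> orth X U"
  by (simp add: orth_def)

lemma finite_Int_orth: "v' \<in> orth X U \<Longrightarrow> u \<in> U \<Longrightarrow> finite (u \<inter> v')"
  by (auto simp: orth_def Int_commute)

text \<open>The usual Galois-connection argument for an antitone polarity. It is what makes tensor
  products and internal homs, whose families are orthogonals, finiteness spaces.\<close>

lemma orth_triple: "orth X (orth X (orth X U)) = orth X U"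
proof (intro equalityI subsetI)
  fix w assume w: "w \<in> orth X (orth X (orth X U))"
  then have "w \<subseteq> X" by (simp add: orth_def)
  \<comment> \<open>\<open>U\<close> is not confined to subsets of \<open>X\<close>, so it is the
    trace \<open>u \<inter> X\<close> that lies in the double orthogonal;
    \<open>w \<subseteq> X\<close> sees no difference.\<close>
  have "finite (w \<inter> u)" if "u \<in> U" for u
  proof -
    have "finite (u \<inter> X \<inter> v)" if "v \<in> orth X U" for v
      by (rule rev_finite_subset[OF finite_Int_orth[OF that \<open>u \<in> U\<close>]]) auto
    then have "u \<inter> X \<in> orth X (orth X U)" by (simp add: orth_def[of _ "orth _ _"])
    from finite_Int_orth[OF w this] show ?thesis
      by (rule rev_finite_subset) (use \<open>w \<subseteq> X\<close> in auto)
  qed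
  with \<open>w \<subseteq> X\<close> show "w \<in> orth X U" by (simp add: orth_def)
next
  fix w assume w: "w \<in> orth X U"
  have "finite (w \<inter> v)" if "v \<in> orth X (orth X U)" for v
    using finite_Int_orth[OF that w] .
  with w show "w \<in> orth X (orth X (orth X U))" by (simp add: orth_def)
qed

lemma fam_subset_pts: "S \<in> FinSp \<Longrightarrow> u \<in> fam S \<Longrightarrow> u \<subseteq> pts S"
  by (auto simp: FinSp_def)

lemma fam_iff:
  "S \<in> FinSp \<Longrightarrow> u \<in> fam S \<longleftrightarrow> u \<subseteq> pts S \<and> (\<forall>u'\<in>orth (pts S) (fam S). finite (u \<inter> u'))"
  unfolding FinSp_def orth_def[of _ "orth _ _"] by blast

text \<open>Membership only tests finiteness of intersections, and that passes to subsets.\<close>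

lemma fam_subset:
  assumes S: "S \<in> FinSp" and u: "u \<in> fam S" and "w \<subseteq> u"
  shows "w \<in> fam S"
proof -
  have "finite (w \<inter> u')" if "u' \<in> orth (pts S) (fam S)" for u'
    by (rule rev_finite_subset[OF finite_Int_orth[OF that u]]) (use \<open>w \<subseteq> u\<close> in auto)
  then show ?thesis using assms by (auto simp: fam_iff)
qed

lemma fam_singleton: "S \<in> FinSp \<Longrightarrow> x \<in> pts S \<Longrightarrow> {x} \<in> fam S"
  by (simp add: fam_iff)

lemma pts_tensor: "pts (S \<otimes> T) = pts S \<times> pts T"
  by (simp add: tensor_def)

section \<open>Criteria for finitary maps\<close>

lemma finite_ppreimage_Int:
  assumes "finite (pimage f u \<inter> v)" and "\<And>y. y \<in> v \<Longrightarrow> finite {x \<in> u. f x = Some y}"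
  shows "finite (u \<inter> ppreimage f v)"
proof -
  have "u \<inter> ppreimage f v = (\<Union>y\<in>pimage f u \<inter> v. {x \<in> u. f x = Some y})"
    by (auto simp: pimage_def ppreimage_def)
  then show ?thesis using assms by simp
qed

lemma HomI:
  assumes dom: "dom f \<subseteq> pts S" and ran: "ran f \<subseteq> pts T"
    and image: "\<And>u. u \<in> fam S \<Longrightarrow> pimage f u \<in> fam T"
    and fibre: "\<And>u y. u \<in> fam S \<Longrightarrow> finite {x \<in> u. f x = Some y}"
  shows "f \<in> Hom S T"
proof -
  have "ppreimage f v' \<in> orth (pts S) (fam S)" if v': "v' \<in> orth (pts T) (fam T)" for v'
  proof -
    have "finite (u \<inter> ppreimage f v')" if "u \<in> fam S" for u
      by (intro finite_ppreimage_Int fibre finite_Int_orth[OF v'] image that)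
    moreover have "ppreimage f v' \<subseteq> pts S" using dom by (auto simp: ppreimage_def)
    ultimately show ?thesis by (auto simp: orth_def Int_commute)
  qed
  then show ?thesis using assms by (auto simp: Hom_def)
qed

text \<open>\<open>pimage f u \<inter> v'\<close> is the image of
  \<open>u \<inter> ppreimage f v'\<close>, so \<open>pimage f u\<close> lies in the double
  orthogonal, which is \<open>fam T\<close>. Fibres are the case of a singleton
  \<open>v'\<close>.\<close>

lemma Hom_orthI:
  assumes T: "T \<in> FinSp" and dom: "dom f \<subseteq> pts S" and ran: "ran f \<subseteq> pts T"
    and fin: "\<And>u v'. u \<in> fam S \<Longrightarrow> v' \<in> orth (pts T) (fam T) \<Longrightarrow> finite (u \<inter> ppreimage f v')"
  shows "f \<in> Hom S T"
proof (rule HomI[OF dom ran])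
  fix u assume u: "u \<in> fam S"
  have "finite (pimage f u \<inter> v')" if "v' \<in> orth (pts T) (fam T)" for v'
  proof (rule finite_surj[OF fin[OF u that]])
    show "pimage f u \<inter> v' \<subseteq> (\<lambda>x. the (f x)) ` (u \<inter> ppreimage f v')"
      by (force simp: pimage_def ppreimage_def)
  qed
  then show "pimage f u \<in> fam T"
    using ran by (subst fam_iff[OF T]) (auto simp: pimage_def ran_def)
  fix y
  show "finite {x \<in> u. f x = Some y}"
  proof (cases "y \<in> pts T")
    case True
    show ?thesis by (rule rev_finite_subset[OF fin[OF u singleton_in_orth[OF True]]])
        (auto simp: ppreimage_def)
  next
    case False
    then have "{x \<in> u. f x = Some y} = {}" using ran by (auto simp: ran_def)
    then show ?thesis by (simp only: finite.emptyI)
  qed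
qed

lemma Hom_dom: "f \<in> Hom S T \<Longrightarrow> f x = Some y \<Longrightarrow> x \<in> pts S"
  by (auto simp: Hom_def)

lemma Hom_ran: "f \<in> Hom S T \<Longrightarrow> f x = Some y \<Longrightarrow> y \<in> pts T"
  by (auto simp: Hom_def ran_def)

lemma Hom_eq_None: "f \<in> Hom S T \<Longrightarrow> x \<notin> pts S \<Longrightarrow> f x = None"
  by (auto simp: Hom_def)

lemma Hom_pimage: "f \<in> Hom S T \<Longrightarrow> u \<in> fam S \<Longrightarrow> pimage f u \<in> fam T"
  by (auto simp: Hom_def)

lemma Hom_ppreimage:
  "f \<in> Hom S T \<Longrightarrow> v' \<in> orth (pts T) (fam T) \<Longrightarrow> ppreimage f v' \<in> orth (pts S) (fam S)"
  by (auto simp: Hom_def)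

text \<open>Converse of the fibre condition in \<open>HomI\<close>: singletons are in the
  orthogonal, and points outside the carrier have empty fibre.\<close>

lemma Hom_fibre:
  assumes f: "f \<in> Hom S T" and u: "u \<in> fam S"
  shows "finite {x \<in> u. f x = Some y}"
proof (cases "y \<in> pts T")
  case True
  have "finite (u \<inter> ppreimage f {y})"
    by (rule finite_Int_orth[OF Hom_ppreimage[OF f singleton_in_orth[OF True]] u])
  then show ?thesis by (rule rev_finite_subset) (auto simp: ppreimage_def)
next
  case False
  then have "{x \<in> u. f x = Some y} = {}" using Hom_ran[OF f] by auto
  then show ?thesis by (simp only: finite.emptyI)
qed

section \<open>Composition and identities\<close>

lemma pimage_map_comp: "pimage (g \<circ>\<^sub>m f) u = pimage g (pimage f u)"
  by (auto simp: pimage_def map_comp_Some_iff)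

lemma ppreimage_map_comp: "ppreimage (g \<circ>\<^sub>m f) v = ppreimage f (ppreimage g v)"
  by (auto simp: ppreimage_def map_comp_Some_iff)

lemma comp_in_Hom:
  assumes "f \<in> Hom A B" "g \<in> Hom B C"
  shows "g \<circ>\<^sub>m f \<in> Hom A C"
proof -
  have "dom (g \<circ>\<^sub>m f) \<subseteq> pts A" "ran (g \<circ>\<^sub>m f) \<subseteq> pts C"
    using Hom_dom[OF assms(1)] Hom_ran[OF assms(2)] by (auto simp: map_comp_Some_iff ran_def)
  then show ?thesis
    using assms by (simp add: Hom_def pimage_map_comp ppreimage_map_comp)
qed

lemma map_comp_assoc: "h \<circ>\<^sub>m (g \<circ>\<^sub>m f) = (h \<circ>\<^sub>m g) \<circ>\<^sub>m f"
  by (rule ext) (simp add: map_comp_def split: option.splits)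

lemma comp_ident: "f \<in> Hom A B \<Longrightarrow> f \<circ>\<^sub>m ident A = f"
  by (rule ext) (auto simp: ident_def map_comp_def restrict_map_def Hom_eq_None)

lemma ident_comp: "f \<in> Hom A B \<Longrightarrow> ident B \<circ>\<^sub>m f = f"
  by (rule ext) (auto simp: ident_def map_comp_def restrict_map_def Hom_ran split: option.splits)

section \<open>Isomorphisms induced by bijections of carriers\<close>

lemma restrict_in_Hom:
  assumes S: "S \<in> FinSp"
    and inj: "inj_on \<phi> (pts S)" and pts: "\<phi> ` pts S \<subseteq> pts T"
    and fam: "\<And>u. u \<in> fam S \<Longrightarrow> \<phi> ` u \<in> fam T"
  shows "(\<lambda>x. Some (\<phi> x)) |` pts S \<in> Hom S T"
proof (rule HomI)
  show "ran ((\<lambda>x. Some (\<phi> x)) |` pts S) \<subseteq> pts T"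
    using pts by (auto simp: ran_def restrict_map_def split: if_splits)
next
  fix u assume u: "u \<in> fam S"
  have "pimage ((\<lambda>x. Some (\<phi> x)) |` pts S) u = \<phi> ` u"
    using fam_subset_pts[OF S u] by (auto simp: pimage_def restrict_map_def)
  then show "pimage ((\<lambda>x. Some (\<phi> x)) |` pts S) u \<in> fam T" using fam[OF u] by simp
  fix y
  show "finite {x \<in> u. ((\<lambda>x. Some (\<phi> x)) |` pts S) x = Some y}"
  proof (rule finite_subset)
    show "{x \<in> u. ((\<lambda>x. Some (\<phi> x)) |` pts S) x = Some y} \<subseteq> \<phi> -` {y} \<inter> pts S"
      by (auto simp: restrict_map_def split: if_splits)
    show "finite (\<phi> -` {y} \<inter> pts S)" by (rule finite_vimage_IntI) (use inj in auto)
  qed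
qed auto

text \<open>Bijectivity makes every fibre at most a point, so only the transport of members in both
  directions has to be checked.\<close>

lemma restrict_in_Iso:
  assumes S: "S \<in> FinSp" and T: "T \<in> FinSp"
    and pts: "\<And>x. x \<in> pts S \<Longrightarrow> \<phi> x \<in> pts T \<and> \<psi> (\<phi> x) = x"
      "\<And>y. y \<in> pts T \<Longrightarrow> \<psi> y \<in> pts S \<and> \<phi> (\<psi> y) = y"
    and fam: "\<And>u. u \<in> fam S \<Longrightarrow> \<phi> ` u \<in> fam T" "\<And>v. v \<in> fam T \<Longrightarrow> \<psi> ` v \<in> fam S"
  shows "(\<lambda>x. Some (\<phi> x)) |` pts S \<in> Iso S T"
proof -
  have "(\<lambda>x. Some (\<phi> x)) |` pts S \<in> Hom S T"
    by (rule restrict_in_Hom[OF S _ _ fam(1)]) (use pts in \<open>auto intro!: inj_on_inverseI[of _ \<psi>]\<close>)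
  moreover have "(\<lambda>y. Some (\<psi> y)) |` pts T \<in> Hom T S"
    by (rule restrict_in_Hom[OF T _ _ fam(2)]) (use pts in \<open>auto intro!: inj_on_inverseI[of _ \<phi>]\<close>)
  moreover have "(\<lambda>y. Some (\<psi> y)) |` pts T \<circ>\<^sub>m (\<lambda>x. Some (\<phi> x)) |` pts S = ident S"
    "(\<lambda>x. Some (\<phi> x)) |` pts S \<circ>\<^sub>m (\<lambda>y. Some (\<psi> y)) |` pts T = ident T"
    by (rule ext, use pts in \<open>auto simp: ident_def map_comp_def restrict_map_def\<close>)+
  ultimately show ?thesis unfolding Iso_def by blast
qed

lemma ident_in_Hom: "A \<in> FinSp \<Longrightarrow> ident A \<in> Hom A A"
  using restrict_in_Hom[of A "\<lambda>x. x" A] by (simp add: ident_def)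


section \<open>The symmetric monoidal structure\<close>

lemma tensor_in_FinSp: "S \<otimes> T \<in> FinSp"
  unfolding FinSp_def tensor_def by (auto simp: orth_triple) (auto simp: orth_def)

lemma unit_in_FinSp: "unit_sp \<in> FinSp"
  by (auto simp: FinSp_def unit_sp_def orth_def intro: finite_subset[OF _ finite])

lemma fam_tensorI:
  "S \<in> FinSp \<Longrightarrow> T \<in> FinSp \<Longrightarrow> u \<in> fam S \<Longrightarrow> v \<in> fam T \<Longrightarrow> w \<subseteq> u \<times> v \<Longrightarrow> w \<in> fam (S \<otimes> T)"
  by (auto simp: fam_tensor)

lemma fam_tensorE:
  assumes "w \<in> fam (S \<otimes> T)" "S \<in> FinSp" "T \<in> FinSp"
  obtains u v where "u \<in> fam S" "v \<in> fam T" "w \<subseteq> u \<times> v"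
  using assms by (auto simp: fam_tensor)

lemma tensor_map_Some_iff:
  "(f \<otimes>\<^sub>m g) p = Some q \<longleftrightarrow> f (fst p) = Some (fst q) \<and> g (snd p) = Some (snd q)"
  by (cases p; cases q) (auto simp: tensor_map_def split: option.splits)

text \<open>Members of a tensor are subsets of boxes \<open>u \<times> v\<close>; on a box, images
  and fibres are contained in products of images and of fibres.\<close>

lemma tensor_map_in_Hom:
  assumes A: "A \<in> FinSp" and B: "B \<in> FinSp" and A': "A' \<in> FinSp" and B': "B' \<in> FinSp"
    and f: "f \<in> Hom A A'" and g: "g \<in> Hom B B'"
  shows "f \<otimes>\<^sub>m g \<in> Hom (A \<otimes> B) (A' \<otimes> B')"
proof (rule HomI)
  show "dom (f \<otimes>\<^sub>m g) \<subseteq> pts (A \<otimes> B)" "ran (f \<otimes>\<^sub>m g) \<subseteq> pts (A' \<otimes> B')"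
    using Hom_dom[OF f] Hom_dom[OF g] Hom_ran[OF f] Hom_ran[OF g]
    by (auto simp: pts_tensor tensor_map_Some_iff ran_def)
next
  fix w assume "w \<in> fam (A \<otimes> B)"
  then obtain u v where u: "u \<in> fam A" and v: "v \<in> fam B" and w: "w \<subseteq> u \<times> v"
    using A B by (rule fam_tensorE)
  show "pimage (f \<otimes>\<^sub>m g) w \<in> fam (A' \<otimes> B')"
  proof (rule fam_tensorI[OF A' B' Hom_pimage[OF f u] Hom_pimage[OF g v]])
    show "pimage (f \<otimes>\<^sub>m g) w \<subseteq> pimage f u \<times> pimage g v"
      using w by (auto simp: pimage_def tensor_map_Some_iff)
  qed
  fix q
  show "finite {p \<in> w. (f \<otimes>\<^sub>m g) p = Some q}"
  proof (rule finite_subset)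
    show "{p \<in> w. (f \<otimes>\<^sub>m g) p = Some q} \<subseteq>
        {x \<in> u. f x = Some (fst q)} \<times> {y \<in> v. g y = Some (snd q)}"
      using w by (auto simp: tensor_map_Some_iff)
    show "finite ({x \<in> u. f x = Some (fst q)} \<times> {y \<in> v. g y = Some (snd q)})"
      by (intro finite_cartesian_product Hom_fibre[OF f u] Hom_fibre[OF g v])
  qed
qed

section \<open>Partial maps compared by their graphs\<close>

lemma map_eqI: "(\<And>x y. f x = Some y \<longleftrightarrow> g x = Some y) \<Longrightarrow> f = g"
  by (rule ext) (metis not_Some_eq)

lemma ident_Some_iff: "ident A x = Some y \<longleftrightarrow> x \<in> pts A \<and> y = x"
  by (auto simp: ident_def restrict_map_def)

lemma assoc_Some_iff:
  "assoc A B C ((a, b), c) = Some q \<longleftrightarrow> a \<in> pts A \<and> b \<in> pts B \<and> c \<in> pts C \<and> q = (a, b, c)"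
  by (auto simp: assoc_def restrict_map_def pts_tensor)

lemma lunit_Some_iff: "lunit A (i, a) = Some b \<longleftrightarrow> a \<in> pts A \<and> b = a"
  by (auto simp: lunit_def restrict_map_def pts_tensor unit_sp_def)

lemma runit_Some_iff: "runit A (a, i) = Some b \<longleftrightarrow> a \<in> pts A \<and> b = a"
  by (auto simp: runit_def restrict_map_def pts_tensor unit_sp_def)

lemma symm_Some_iff: "symm A B (a, b) = Some q \<longleftrightarrow> a \<in> pts A \<and> b \<in> pts B \<and> q = (b, a)"
  by (auto simp: symm_def restrict_map_def pts_tensor)

text \<open>Together with \<open>map_eqI\<close> these turn an equation between composites into an
  equivalence about points, in which the carrier conditions of the restricted structural maps are
  explicit.\<close>

lemmas Some_iffs =
  ident_Some_iff assoc_Some_iff lunit_Some_iff runit_Some_iff symm_Some_iff tensor_map_Some_iff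
  map_comp_Some_iff pts_tensor

lemma tensor_map_ident: "ident A \<otimes>\<^sub>m ident B = ident (A \<otimes> B)"
  by (rule map_eqI) (auto simp: Some_iffs)

lemma tensor_map_comp: "(f' \<circ>\<^sub>m f) \<otimes>\<^sub>m (g' \<circ>\<^sub>m g) = (f' \<otimes>\<^sub>m g') \<circ>\<^sub>m (f \<otimes>\<^sub>m g)"
  by (rule map_eqI) (auto simp: Some_iffs)

section \<open>Structural isomorphisms and their naturality\<close>

lemma assoc_in_Iso:
  assumes A: "A \<in> FinSp" and B: "B \<in> FinSp" and C: "C \<in> FinSp"
  shows "assoc A B C \<in> Iso ((A \<otimes> B) \<otimes> C) (A \<otimes> (B \<otimes> C))"
proof -
  note I = tensor_in_FinSp
  have "(\<lambda>p. Some (fst (fst p), snd (fst p), snd p)) |` pts ((A \<otimes> B) \<otimes> C) \<in>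
      Iso ((A \<otimes> B) \<otimes> C) (A \<otimes> (B \<otimes> C))"
  proof (rule restrict_in_Iso[where \<psi> = "\<lambda>p. ((fst p, fst (snd p)), snd (snd p))", OF I I])
    fix w assume "w \<in> fam ((A \<otimes> B) \<otimes> C)"
    \<comment> \<open>Two decompositions enclose \<open>w\<close> in a triple box
      \<open>(u \<times> v) \<times> t\<close>, and rebracketing carries that box to
      \<open>u \<times> (v \<times> t)\<close>.\<close>
    then obtain w' t u v where "u \<in> fam A" "v \<in> fam B" "t \<in> fam C" "w' \<subseteq> u \<times> v" "w \<subseteq> w' \<times> t"
      using A B C I by (metis fam_tensorE)
    then show "(\<lambda>p. (fst (fst p), snd (fst p), snd p)) ` w \<in> fam (A \<otimes> (B \<otimes> C))"
      by (intro fam_tensorI[OF A I, where u = u and v = "v \<times> t"] fam_tensorI[OF B C, where u = v and v = t]) auto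
  next
    fix w assume "w \<in> fam (A \<otimes> (B \<otimes> C))"
    then obtain w' t u v where "u \<in> fam A" "v \<in> fam B" "t \<in> fam C" "w' \<subseteq> v \<times> t" "w \<subseteq> u \<times> w'"
      using A B C I by (metis fam_tensorE)
    then show "(\<lambda>p. ((fst p, fst (snd p)), snd (snd p))) ` w \<in> fam ((A \<otimes> B) \<otimes> C)"
      by (intro fam_tensorI[OF I C, where u = "u \<times> v" and v = t] fam_tensorI[OF A B, where u = u and v = v]) auto
  qed (auto simp: pts_tensor)
  \<comment> \<open>The form with projections fits \<open>restrict_in_Iso\<close>; it agrees with
    the pattern-matching definition.\<close>
  moreover have "assoc A B C = (\<lambda>p. Some (fst (fst p), snd (fst p), snd p)) |` pts ((A \<otimes> B) \<otimes> C)"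
    by (rule ext) (auto simp: assoc_def restrict_map_def)
  ultimately show ?thesis by simp
qed

lemma lunit_in_Iso:
  assumes A: "A \<in> FinSp"
  shows "lunit A \<in> Iso (unit_sp \<otimes> A) A"
proof -
  have "(\<lambda>p. Some (snd p)) |` pts (unit_sp \<otimes> A) \<in> Iso (unit_sp \<otimes> A) A"
  proof (rule restrict_in_Iso[where \<psi> = "\<lambda>a. ((), a)", OF tensor_in_FinSp A])
    fix w assume "w \<in> fam (unit_sp \<otimes> A)"
    then obtain t u where "u \<in> fam A" "w \<subseteq> t \<times> u"
      using unit_in_FinSp A by (metis fam_tensorE)
    then have "u \<in> fam A" "snd ` w \<subseteq> u" by auto
    then show "snd ` w \<in> fam A" by (rule fam_subset[OF A])
  next
    fix u assume "u \<in> fam A"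
    then show "Pair () ` u \<in> fam (unit_sp \<otimes> A)"
      by (intro fam_tensorI[OF unit_in_FinSp A, of "{()}" u]) (auto simp: unit_sp_def)
  qed (auto simp: pts_tensor unit_sp_def)
  moreover have "lunit A = (\<lambda>p. Some (snd p)) |` pts (unit_sp \<otimes> A)"
    by (rule ext) (auto simp: lunit_def restrict_map_def)
  ultimately show ?thesis by simp
qed

lemma runit_in_Iso:
  assumes A: "A \<in> FinSp"
  shows "runit A \<in> Iso (A \<otimes> unit_sp) A"
proof -
  have "(\<lambda>p. Some (fst p)) |` pts (A \<otimes> unit_sp) \<in> Iso (A \<otimes> unit_sp) A"
  proof (rule restrict_in_Iso[where \<psi> = "\<lambda>a. (a, ())", OF tensor_in_FinSp A])
    fix w assume "w \<in> fam (A \<otimes> unit_sp)"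
    then obtain t u where "u \<in> fam A" "w \<subseteq> u \<times> t"
      using unit_in_FinSp A by (metis fam_tensorE)
    then have "u \<in> fam A" "fst ` w \<subseteq> u" by auto
    then show "fst ` w \<in> fam A" by (rule fam_subset[OF A])
  next
    fix u assume "u \<in> fam A"
    then show "(\<lambda>a. (a, ())) ` u \<in> fam (A \<otimes> unit_sp)"
      by (intro fam_tensorI[OF A unit_in_FinSp, of u "{()}"]) (auto simp: unit_sp_def)
  qed (auto simp: pts_tensor unit_sp_def)
  moreover have "runit A = (\<lambda>p. Some (fst p)) |` pts (A \<otimes> unit_sp)"
    by (rule ext) (auto simp: runit_def restrict_map_def)
  ultimately show ?thesis by simp
qed

lemma symm_in_Iso:
  assumes A: "A \<in> FinSp" and B: "B \<in> FinSp"
  shows "symm A B \<in> Iso (A \<otimes> B) (B \<otimes> A)"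
proof -
  \<comment> \<open>Stated over fresh types so that it serves both the map and its inverse.\<close>
  have swap: "prod.swap ` w \<in> fam (T \<otimes> S)"
    if "w \<in> fam (S \<otimes> T)" and S: "S \<in> FinSp" and T: "T \<in> FinSp"
    for w and S :: "'c fspace" and T :: "'d fspace"
  proof -
    obtain u v where "u \<in> fam S" "v \<in> fam T" "w \<subseteq> u \<times> v" using \<open>w \<in> _\<close> S T by (rule fam_tensorE)
    then show ?thesis by (intro fam_tensorI[OF T S, of v u]) auto
  qed
  have "(\<lambda>p. Some (prod.swap p)) |` pts (A \<otimes> B) \<in> Iso (A \<otimes> B) (B \<otimes> A)"
    by (rule restrict_in_Iso[where \<psi> = prod.swap, OF tensor_in_FinSp tensor_in_FinSp])
      (use A B in \<open>auto simp: pts_tensor intro: swap\<close>)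
  moreover have "symm A B = (\<lambda>p. Some (prod.swap p)) |` pts (A \<otimes> B)"
    by (rule ext) (auto simp: symm_def restrict_map_def)
  ultimately show ?thesis by simp
qed

text \<open>Structural maps are cut down to carriers; the two sides are defined at the same points
  because membership in \<open>Hom\<close> puts arguments and values of \<open>f\<close>,
  \<open>g\<close>, \<open>h\<close> into the right carriers.\<close>

lemma assoc_natural:
  assumes "f \<in> Hom A A'" "g \<in> Hom B B'" "h \<in> Hom C C'"
  shows "assoc A' B' C' \<circ>\<^sub>m ((f \<otimes>\<^sub>m g) \<otimes>\<^sub>m h) = (f \<otimes>\<^sub>m (g \<otimes>\<^sub>m h)) \<circ>\<^sub>m assoc A B C"
  by (rule map_eqI) (use assms in \<open>auto simp: Some_iffs intro: Hom_dom Hom_ran\<close>)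

lemma lunit_natural:
  "f \<in> Hom A A' \<Longrightarrow> lunit A' \<circ>\<^sub>m (ident unit_sp \<otimes>\<^sub>m f) = f \<circ>\<^sub>m lunit A"
  by (rule map_eqI) (auto simp: Some_iffs unit_sp_def intro: Hom_dom Hom_ran)

lemma runit_natural:
  "f \<in> Hom A A' \<Longrightarrow> runit A' \<circ>\<^sub>m (f \<otimes>\<^sub>m ident unit_sp) = f \<circ>\<^sub>m runit A"
  by (rule map_eqI) (auto simp: Some_iffs unit_sp_def intro: Hom_dom Hom_ran)

lemma symm_natural:
  assumes "f \<in> Hom A A'" "g \<in> Hom B B'"
  shows "symm A' B' \<circ>\<^sub>m (f \<otimes>\<^sub>m g) = (g \<otimes>\<^sub>m f) \<circ>\<^sub>m symm A B"
  by (rule map_eqI) (use assms in \<open>auto simp: Some_iffs intro: Hom_dom Hom_ran\<close>)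

section \<open>Coherence laws\<close>

lemma pentagon:
  "assoc A B (C \<otimes> D) \<circ>\<^sub>m assoc (A \<otimes> B) C D =
   (ident A \<otimes>\<^sub>m assoc B C D) \<circ>\<^sub>m (assoc A (B \<otimes> C) D \<circ>\<^sub>m (assoc A B C \<otimes>\<^sub>m ident D))"
  by (rule map_eqI) (auto simp: Some_iffs unit_sp_def)

lemma triangle: "(ident A \<otimes>\<^sub>m lunit B) \<circ>\<^sub>m assoc A unit_sp B = runit A \<otimes>\<^sub>m ident B"
  by (rule map_eqI) (auto simp: Some_iffs unit_sp_def)

text \<open>Both sides send \<open>((a, b), c)\<close> to \<open>(b, c, a)\<close> on the same
  carrier. The hexagon for the inverse associator follows from this one since the symmetry is
  involutive.\<close>

lemma hexagon:
  "assoc B C A \<circ>\<^sub>m (symm A (B \<otimes> C) \<circ>\<^sub>m assoc A B C) =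
   (ident B \<otimes>\<^sub>m symm A C) \<circ>\<^sub>m (assoc B A C \<circ>\<^sub>m (symm A B \<otimes>\<^sub>m ident C))"
  by (rule map_eqI) (auto simp: Some_iffs unit_sp_def)

lemma symm_involutive: "symm B A \<circ>\<^sub>m symm A B = ident (A \<otimes> B)"
  by (rule map_eqI) (auto simp: Some_iffs unit_sp_def)

lemma lunit_symm: "lunit A \<circ>\<^sub>m symm A unit_sp = runit A"
  by (rule map_eqI) (auto simp: Some_iffs unit_sp_def)


section \<open>Closedness\<close>

lemma pts_ihom: "pts (ihom X Y) = Hom X Y - {Map.empty}"
  by (simp add: ihom_def Let_def)

text \<open>Unfolds the orthogonal at its generators; as \<open>W\<close> lies in the carrier, each
  generator may be cut down to \<open>W\<close>. Membership thus becomes a finiteness test for each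
  pair \<open>(u, v')\<close>.\<close>

lemma fam_ihom_iff:
  "W \<in> fam (ihom X Y) \<longleftrightarrow> W \<subseteq> pts (ihom X Y) \<and>
     (\<forall>u\<in>fam X. \<forall>v'\<in>orth (pts Y) (fam Y). finite {h \<in> W. pimage h u \<inter> v' \<noteq> {}})"
proof -
  have "W \<in> fam (ihom X Y) \<longleftrightarrow> W \<subseteq> pts (ihom X Y) \<and> (\<forall>u\<in>fam X. \<forall>v'\<in>orth (pts Y) (fam Y).
      finite (W \<inter> {h \<in> pts (ihom X Y). pimage h u \<inter> v' \<noteq> {}}))"
    unfolding ihom_def Let_def orth_def[of "_ - _"] fspace.simps by blast
  moreover have "W \<inter> {h \<in> pts (ihom X Y). pimage h u \<inter> v' \<noteq> {}} = {h \<in> W. pimage h u \<inter> v' \<noteq> {}}"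
    if "W \<subseteq> pts (ihom X Y)" for u v'
    using that by auto
  ultimately show ?thesis by auto
qed

text \<open>A generating family lies inside its double orthogonal. This makes the preimage condition
  of an arrow into \<open>ihom X Y\<close> usable for uncurrying.\<close>

lemma ihom_generator_in_orth:
  assumes "u \<in> fam X" "v' \<in> orth (pts Y) (fam Y)"
  shows "{h \<in> pts (ihom X Y). pimage h u \<inter> v' \<noteq> {}} \<in> orth (pts (ihom X Y)) (fam (ihom X Y))"
proof -
  have "finite ({h \<in> pts (ihom X Y). pimage h u \<inter> v' \<noteq> {}} \<inter> W)" if "W \<in> fam (ihom X Y)" for W
  proof (rule rev_finite_subset)
    show "finite {h \<in> W. pimage h u \<inter> v' \<noteq> {}}" using that assms by (simp add: fam_ihom_iff)
  qed auto
  then show ?thesis by (auto simp: orth_def)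
qed

text \<open>The family is an orthogonal, hence closed by \<open>orth_triple\<close>.\<close>

lemma ihom_in_FinSp: "ihom X Y \<in> FinSp"
  unfolding FinSp_def ihom_def Let_def by (auto simp: orth_triple) (auto simp: orth_def)

lemma ihom_map_Some_iff:
  "ihom_map X Y k h = Some h' \<longleftrightarrow> h \<in> pts (ihom X Y) \<and> k \<circ>\<^sub>m h = h' \<and> h' \<noteq> Map.empty"
  by (auto simp: ihom_map_def restrict_map_def)

lemma ihom_map_in_Hom:
  assumes X: "X \<in> FinSp" and k: "k \<in> Hom Y Y'"
  shows "ihom_map X Y k \<in> Hom (ihom X Y) (ihom X Y')"
proof (rule HomI)
  show "dom (ihom_map X Y k) \<subseteq> pts (ihom X Y)" by (auto simp: ihom_map_Some_iff)
  show ran: "ran (ihom_map X Y k) \<subseteq> pts (ihom X Y')"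
    using comp_in_Hom[OF _ k] by (auto simp: ran_def ihom_map_Some_iff pts_ihom)
  fix W assume W: "W \<in> fam (ihom X Y)"
  have fin: "finite {h \<in> W. pimage h u \<inter> v' \<noteq> {}}"
    if "u \<in> fam X" "v' \<in> orth (pts Y) (fam Y)" for u v'
    using W that by (simp add: fam_ihom_iff)
  \<comment> \<open>Testing \<open>k \<circ>\<^sub>m h\<close> against \<open>(u, v')\<close>
    amounts to testing \<open>h\<close> against \<open>(u, ppreimage k v')\<close>.\<close>
  have "finite {h' \<in> pimage (ihom_map X Y k) W. pimage h' u \<inter> v' \<noteq> {}}"
    if u: "u \<in> fam X" and v': "v' \<in> orth (pts Y') (fam Y')" for u v'
  proof (rule finite_surj[OF fin[OF u Hom_ppreimage[OF k v']]])
    show "{h' \<in> pimage (ihom_map X Y k) W. pimage h' u \<inter> v' \<noteq> {}} \<subseteq>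
        (\<lambda>h. k \<circ>\<^sub>m h) ` {h \<in> W. pimage h u \<inter> ppreimage k v' \<noteq> {}}"
      by (fastforce simp: pimage_def ppreimage_def ihom_map_Some_iff map_comp_Some_iff)
  qed
  moreover have "pimage (ihom_map X Y k) W \<subseteq> pts (ihom X Y')"
    using ran by (auto simp: pimage_def ran_def)
  ultimately show "pimage (ihom_map X Y k) W \<in> fam (ihom X Y')" by (simp add: fam_ihom_iff)
  fix h'
  show "finite {h \<in> W. ihom_map X Y k h = Some h'}"
  proof (cases "h' \<in> pts (ihom X Y')")
    case True
    \<comment> \<open>Points of \<open>ihom X Y'\<close> are nonempty, so \<open>h'\<close> has a
      value \<open>y\<close> at some \<open>x\<close>. Every \<open>h\<close> in the fibre sends
      \<open>x\<close> into \<open>ppreimage k {y}\<close>, so a single test bounds the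
      fibre.\<close>
    then obtain x y where xy: "h' x = Some y" and h': "h' \<in> Hom X Y'"
      by (auto simp: pts_ihom fun_eq_iff)
    have x: "{x} \<in> fam X" using X Hom_dom[OF h' xy] by (rule fam_singleton)
    have "ppreimage k {y} \<in> orth (pts Y) (fam Y)"
      by (intro Hom_ppreimage[OF k] singleton_in_orth Hom_ran[OF h' xy])
    from fin[OF x this] show ?thesis
      by (rule rev_finite_subset)
        (use xy in \<open>auto simp: pimage_def ppreimage_def ihom_map_Some_iff map_comp_Some_iff\<close>)
  next
    case False
    then have "{h \<in> W. ihom_map X Y k h = Some h'} = {}" using ran by (auto simp: ran_def)
    then show ?thesis by (simp only: finite.emptyI)
  qed
qed

lemma ihom_map_ident: "ihom_map X Y (ident Y) = ident (ihom X Y)"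
proof (rule ext)
  fix h
  show "ihom_map X Y (ident Y) h = ident (ihom X Y) h"
    by (cases "h \<in> pts (ihom X Y)")
      (auto simp: ihom_map_def ident_def[of "ihom X Y"] pts_ihom ident_comp restrict_map_def)
qed

lemma comp_empty: "k \<circ>\<^sub>m Map.empty = Map.empty"
  by (rule ext) simp

text \<open>Dropping an empty composite at the intermediate stage agrees with dropping it at the
  end, since any map after the empty one is empty. A nonempty \<open>k \<circ>\<^sub>m h\<close> is
  a point of \<open>ihom X Y'\<close>, where the outer map acts by composition.\<close>

lemma ihom_map_comp:
  assumes "k \<in> Hom Y Y'"
  shows "ihom_map X Y (k' \<circ>\<^sub>m k) = ihom_map X Y' k' \<circ>\<^sub>m ihom_map X Y k"
proof (rule ext)
  fix h
  show "ihom_map X Y (k' \<circ>\<^sub>m k) h = (ihom_map X Y' k' \<circ>\<^sub>m ihom_map X Y k) h"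
    by (cases "k \<circ>\<^sub>m h = Map.empty")
      (use comp_in_Hom[OF _ assms, of h X] in
        \<open>auto simp: ihom_map_def restrict_map_def pts_ihom map_comp_assoc[symmetric] comp_empty
           map_comp_def[of "_ |` _"]\<close>)
qed

section \<open>Transposition and its inverse\<close>

lemma pcurry_Some_iff: "pcurry f z = Some h \<longleftrightarrow> h = (\<lambda>x. f (z, x)) \<and> h \<noteq> Map.empty"
  by (auto simp: pcurry_def Let_def)

text \<open>The box \<open>w \<times> u\<close> is itself a member of the tensor family. All
  finiteness claims about \<open>pcurry f\<close> and its values come from images and projections of
  this set.\<close>

lemma finite_section:
  assumes Z: "Z \<in> FinSp" and X: "X \<in> FinSp" and f: "f \<in> Hom (Z \<otimes> X) Y"
    and w: "w \<in> fam Z" and u: "u \<in> fam X" and v': "v' \<in> orth (pts Y) (fam Y)"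
  shows "finite ((w \<times> u) \<inter> ppreimage f v')"
  by (rule finite_Int_orth[OF Hom_ppreimage[OF f v'] fam_tensorI[OF Z X w u order_refl]])

lemma section_in_Hom:
  assumes Z: "Z \<in> FinSp" and X: "X \<in> FinSp" and Y: "Y \<in> FinSp" and f: "f \<in> Hom (Z \<otimes> X) Y"
  shows "(\<lambda>x. f (z, x)) \<in> Hom X Y"
proof (rule Hom_orthI[OF Y])
  show "dom (\<lambda>x. f (z, x)) \<subseteq> pts X" "ran (\<lambda>x. f (z, x)) \<subseteq> pts Y"
    using Hom_dom[OF f] Hom_ran[OF f] by (auto simp: pts_tensor ran_def)
next
  fix u v' assume u: "u \<in> fam X" and v': "v' \<in> orth (pts Y) (fam Y)"
  show "finite (u \<inter> ppreimage (\<lambda>x. f (z, x)) v')"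
  proof (cases "z \<in> pts Z")
    case True
    \<comment> \<open>For \<open>w = {z}\<close>, the second projection of the finite set covers the
      slice over \<open>z\<close>.\<close>
    show ?thesis
      by (rule finite_surj[OF finite_section[OF Z X f fam_singleton[OF Z True] u v'], of _ snd])
        (force simp: ppreimage_def)
  next
    case False
    then have "ppreimage (\<lambda>x. f (z, x)) v' = {}"
      using Hom_dom[OF f] by (auto simp: pts_tensor ppreimage_def)
    then show ?thesis by simp
  qed
qed

lemma pcurry_in_Hom:
  assumes Z: "Z \<in> FinSp" and X: "X \<in> FinSp" and Y: "Y \<in> FinSp" and f: "f \<in> Hom (Z \<otimes> X) Y"
  shows "pcurry f \<in> Hom Z (ihom X Y)"
proof (rule HomI)
  show "dom (pcurry f) \<subseteq> pts Z"
    using Hom_dom[OF f] by (auto simp: pcurry_Some_iff pts_tensor fun_eq_iff)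
  show ran: "ran (pcurry f) \<subseteq> pts (ihom X Y)"
    using section_in_Hom[OF assms] by (auto simp: ran_def pcurry_Some_iff pts_ihom)
  fix w assume w: "w \<in> fam Z"
  have "finite {h \<in> pimage (pcurry f) w. pimage h u \<inter> v' \<noteq> {}}"
    if u: "u \<in> fam X" and v': "v' \<in> orth (pts Y) (fam Y)" for u v'
  proof (rule finite_surj[OF finite_section[OF Z X f w u v']])
    \<comment> \<open>An arrow \<open>h\<close> that meets \<open>v'\<close> on \<open>u\<close>
      does so at some \<open>x\<close>, and \<open>h = f(z, -)\<close> for some \<open>z\<close>;
      the finitely many such pairs \<open>(z, x)\<close> account for all these
      \<open>h\<close>.\<close>
    show "{h \<in> pimage (pcurry f) w. pimage h u \<inter> v' \<noteq> {}} \<subseteq>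
        (\<lambda>p x. f (fst p, x)) ` ((w \<times> u) \<inter> ppreimage f v')"
    proof
      fix h assume "h \<in> {h \<in> pimage (pcurry f) w. pimage h u \<inter> v' \<noteq> {}}"
      then obtain z x y where z: "z \<in> w" "pcurry f z = Some h"
        and x: "x \<in> u" "h x = Some y" "y \<in> v'"
        by (auto simp: pimage_def)
      then have h: "h = (\<lambda>x. f (fst (z, x), x))" by (simp add: pcurry_Some_iff)
      have "(z, x) \<in> (w \<times> u) \<inter> ppreimage f v'" using x z h by (auto simp: ppreimage_def)
      then show "h \<in> (\<lambda>p x. f (fst p, x)) ` ((w \<times> u) \<inter> ppreimage f v')"
        using h by (intro image_eqI[of _ _ "(z, x)"]) simp_all
    qed
  qed
  moreover have "pimage (pcurry f) w \<subseteq> pts (ihom X Y)"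
    using ran by (auto simp: pimage_def ran_def)
  ultimately show "pimage (pcurry f) w \<in> fam (ihom X Y)" by (simp add: fam_ihom_iff)
  fix h
  show "finite {z \<in> w. pcurry f z = Some h}"
  proof (cases "h \<in> pts (ihom X Y)")
    case True
    \<comment> \<open>Nonemptiness of \<open>h\<close> again: one value \<open>h x = Some y\<close>
      confines all \<open>z\<close> with transpose \<open>h\<close> to a projection of a finite
      set.\<close>
    then obtain x y where xy: "h x = Some y" and h: "h \<in> Hom X Y"
      by (auto simp: pts_ihom fun_eq_iff)
    have "finite ((w \<times> {x}) \<inter> ppreimage f {y})"
      by (rule finite_section[OF Z X f w fam_singleton[OF X Hom_dom[OF h xy]]
            singleton_in_orth[OF Hom_ran[OF h xy]]])
    then show ?thesis
    proof (rule finite_surj)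
      show "{z \<in> w. pcurry f z = Some h} \<subseteq> fst ` ((w \<times> {x}) \<inter> ppreimage f {y})"
      proof
        fix z assume "z \<in> {z \<in> w. pcurry f z = Some h}"
        then have "(z, x) \<in> (w \<times> {x}) \<inter> ppreimage f {y}"
          using xy by (simp add: ppreimage_def pcurry_Some_iff)
        then show "z \<in> fst ` ((w \<times> {x}) \<inter> ppreimage f {y})" by (rule image_eqI[rotated]) simp
      qed
    qed
  next
    case False
    then have "{z \<in> w. pcurry f z = Some h} = {}" using ran by (auto simp: ran_def)
    then show ?thesis by (simp only: finite.emptyI)
  qed
qed

text \<open>Inverse of \<open>pcurry\<close>: an undefined \<open>g z\<close> yields an empty
  section, just as \<open>pcurry\<close> turns an empty section into an undefined value.\<close>

definition puncurry :: "('z \<rightharpoonup> ('x \<rightharpoonup> 'y)) \<Rightarrow> ('z \<times> 'x \<rightharpoonup> 'y)" where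
  "puncurry g = (\<lambda>(z, x). case g z of None \<Rightarrow> None | Some h \<Rightarrow> h x)"

lemma puncurry_Some_iff:
  "puncurry g (z, x) = Some y \<longleftrightarrow> (\<exists>h. g z = Some h \<and> h x = Some y)"
  by (simp add: puncurry_def split: option.splits)

text \<open>The pairs sent into \<open>v'\<close> lie over finitely many \<open>z\<close>, by the
  preimage of a generator of the internal hom, and each slice is finite because each
  \<open>g z\<close> is itself finitary.\<close>

lemma puncurry_in_Hom:
  assumes Z: "Z \<in> FinSp" and X: "X \<in> FinSp" and Y: "Y \<in> FinSp" and g: "g \<in> Hom Z (ihom X Y)"
  shows "puncurry g \<in> Hom (Z \<otimes> X) Y"
proof (rule Hom_orthI[OF Y])
  have val: "h \<in> Hom X Y" if "g z = Some h" for z h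
    using Hom_ran[OF g that] by (simp add: pts_ihom)
  show "dom (puncurry g) \<subseteq> pts (Z \<otimes> X)" "ran (puncurry g) \<subseteq> pts Y"
    using Hom_dom[OF g] by (auto simp: pts_tensor ran_def puncurry_Some_iff
        intro: Hom_dom[OF val] Hom_ran[OF val])
  fix t v' assume tZX: "t \<in> fam (Z \<otimes> X)" and v': "v' \<in> orth (pts Y) (fam Y)"
  obtain w u where w: "w \<in> fam Z" and u: "u \<in> fam X" and t: "t \<subseteq> w \<times> u"
    using tZX Z X by (rule fam_tensorE)
  define B where "B = {h \<in> pts (ihom X Y). pimage h u \<inter> v' \<noteq> {}}"
  have "finite (w \<inter> ppreimage g B)"
    unfolding B_def by (rule finite_Int_orth[OF Hom_ppreimage[OF g ihom_generator_in_orth[OF u v']] w])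
  \<comment> \<open>For such \<open>z\<close> the value \<open>g z\<close> is defined, so
    \<open>the (g z)\<close> is a genuine arrow.\<close>
  moreover have "finite (u \<inter> ppreimage (the (g z)) v')" if "z \<in> w \<inter> ppreimage g B" for z
    by (rule finite_Int_orth[OF Hom_ppreimage[OF val v'] u])
      (use that in \<open>auto simp: ppreimage_def\<close>)
  ultimately have "finite (SIGMA z:w \<inter> ppreimage g B. u \<inter> ppreimage (the (g z)) v')"
    by (rule finite_SigmaI)
  then show "finite (t \<inter> ppreimage (puncurry g) v')"
  proof (rule rev_finite_subset, intro subsetI)
    fix p assume p: "p \<in> t \<inter> ppreimage (puncurry g) v'"
    obtain z x where zx: "p = (z, x)" by fastforce
    with p t obtain h y where "z \<in> w" "x \<in> u" "y \<in> v'" and h: "g z = Some h" "h x = Some y"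
      by (auto simp: ppreimage_def puncurry_Some_iff)
    moreover from this have "h \<in> B" using Hom_ran[OF g h(1)] by (auto simp: B_def pimage_def)
    ultimately show "p \<in> (SIGMA z:w \<inter> ppreimage g B. u \<inter> ppreimage (the (g z)) v')"
      using zx by (auto simp: ppreimage_def)
  qed
qed

lemma puncurry_pcurry: "puncurry (pcurry f) = f"
  by (rule ext) (auto simp: puncurry_def pcurry_def Let_def fun_eq_iff)

text \<open>Values of \<open>g\<close> are points of \<open>ihom X Y\<close>, hence never the empty
  map; a value \<open>Some Map.empty\<close> would come back as \<open>None\<close>.\<close>

lemma pcurry_puncurry:
  assumes "g \<in> Hom Z (ihom X Y)"
  shows "pcurry (puncurry g) = g"
proof (rule ext)
  fix z
  show "pcurry (puncurry g) z = g z"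
    using Hom_ran[OF assms, of z]
    by (cases "g z") (auto simp: puncurry_def pcurry_def Let_def pts_ihom)
qed

section \<open>The natural bijection of hom-sets\<close>

lemma bij_betw_pcurry:
  assumes "Z \<in> FinSp" "X \<in> FinSp" "Y \<in> FinSp"
  shows "bij_betw pcurry (Hom (Z \<otimes> X) Y) (Hom Z (ihom X Y))"
  by (rule bij_betw_byWitness[where f' = puncurry])
    (use assms in \<open>auto intro: pcurry_in_Hom puncurry_in_Hom simp: puncurry_pcurry pcurry_puncurry\<close>)

lemma pcurry_natural:
  assumes Z: "Z \<in> FinSp" and X: "X \<in> FinSp" and Y: "Y \<in> FinSp" and f: "f \<in> Hom (Z \<otimes> X) Y"
  shows "pcurry (k \<circ>\<^sub>m (f \<circ>\<^sub>m (g \<otimes>\<^sub>m ident X))) = ihom_map X Y k \<circ>\<^sub>m (pcurry f \<circ>\<^sub>m g)"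
proof (rule ext)
  fix z'
  show "pcurry (k \<circ>\<^sub>m (f \<circ>\<^sub>m (g \<otimes>\<^sub>m ident X))) z' = (ihom_map X Y k \<circ>\<^sub>m (pcurry f \<circ>\<^sub>m g)) z'"
  proof (cases "g z'")
    case None
    then show ?thesis by (simp add: pcurry_def tensor_map_def map_comp_def)
  next
    case (Some z)
    \<comment> \<open>The factor \<open>ident X\<close> only discards \<open>x\<close> outside
      \<open>pts X\<close>, and there \<open>f (z, x)\<close> is already undefined.\<close>
    have "f (z, x) = None" if "x \<notin> pts X" for x
      using Hom_eq_None[OF f] that by (auto simp: pts_tensor)
    then have "(k \<circ>\<^sub>m (f \<circ>\<^sub>m (g \<otimes>\<^sub>m ident X))) (z', x) = (k \<circ>\<^sub>m (\<lambda>x. f (z, x))) x" for x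
      using Some by (auto simp: tensor_map_def map_comp_def ident_def restrict_map_def)
    then have "pcurry (k \<circ>\<^sub>m (f \<circ>\<^sub>m (g \<otimes>\<^sub>m ident X))) z' =
        (let h = k \<circ>\<^sub>m (\<lambda>x. f (z, x)) in if h = Map.empty then None else Some h)"
      unfolding pcurry_def by (simp only:)
    \<comment> \<open>If the section is empty, \<open>pcurry f z\<close> is undefined and
      \<open>k\<close> after the section is empty; otherwise the section is a point of
      \<open>ihom X Y\<close>, where \<open>ihom_map X Y k\<close> composes with
      \<open>k\<close>.\<close>
    also have "\<dots> = (ihom_map X Y k \<circ>\<^sub>m pcurry f) z"
      using section_in_Hom[OF Z X Y f, of z]
      by (cases "(\<lambda>x. f (z, x)) = Map.empty")
        (simp_all add: pcurry_def ihom_map_def pts_ihom comp_empty Let_def map_comp_def[of "_ |` _"])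
    finally show ?thesis using Some by (simp add: map_comp_def)
  qed
qed

text \<open>Adjointness takes the form of a hom-set bijection. One equation in \<open>g\<close> and
  \<open>k\<close> expresses naturality in both \<open>Z\<close> and \<open>Y\<close>; inserting an
  identity for one of them isolates the other variable.\<close>

theorem proposition3p3:
  shows
    "\<comment> \<open>category\<close>
     (\<forall>A\<in>(FinSp :: 'a fspace set). ident A \<in> Hom A A) \<and>
     (\<forall>A\<in>(FinSp :: 'a fspace set). \<forall>B\<in>(FinSp :: 'b fspace set). \<forall>C\<in>(FinSp :: 'c fspace set).
        \<forall>f\<in>Hom A B. \<forall>g\<in>Hom B C. g \<circ>\<^sub>m f \<in> Hom A C) \<and>
     (\<forall>A\<in>(FinSp :: 'a fspace set). \<forall>B\<in>(FinSp :: 'b fspace set).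
        \<forall>f\<in>Hom A B. f \<circ>\<^sub>m ident A = f \<and> ident B \<circ>\<^sub>m f = f) \<and>
     (\<forall>A\<in>(FinSp :: 'a fspace set). \<forall>B\<in>(FinSp :: 'b fspace set).
      \<forall>C\<in>(FinSp :: 'c fspace set). \<forall>D\<in>(FinSp :: 'd fspace set).
        \<forall>f\<in>Hom A B. \<forall>g\<in>Hom B C. \<forall>h\<in>Hom C D. h \<circ>\<^sub>m (g \<circ>\<^sub>m f) = (h \<circ>\<^sub>m g) \<circ>\<^sub>m f) \<and>

     \<comment> \<open>the tensor product is a bifunctor, and the unit is an object\<close>
     (\<forall>A\<in>(FinSp :: 'a fspace set). \<forall>B\<in>(FinSp :: 'b fspace set). A \<otimes> B \<in> FinSp) \<and>
     unit_sp \<in> FinSp \<and>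
     (\<forall>A\<in>(FinSp :: 'a fspace set). \<forall>B\<in>(FinSp :: 'b fspace set).
      \<forall>A'\<in>(FinSp :: 'e fspace set). \<forall>B'\<in>(FinSp :: 'f fspace set).
        \<forall>f\<in>Hom A A'. \<forall>g\<in>Hom B B'. f \<otimes>\<^sub>m g \<in> Hom (A \<otimes> B) (A' \<otimes> B')) \<and>
     (\<forall>A\<in>(FinSp :: 'a fspace set). \<forall>B\<in>(FinSp :: 'b fspace set).
        ident A \<otimes>\<^sub>m ident B = ident (A \<otimes> B)) \<and>
     (\<forall>A\<in>(FinSp :: 'a fspace set). \<forall>B\<in>(FinSp :: 'b fspace set).
      \<forall>A'\<in>(FinSp :: 'e fspace set). \<forall>B'\<in>(FinSp :: 'f fspace set).
      \<forall>A''\<in>(FinSp :: 'g fspace set). \<forall>B''\<in>(FinSp :: 'h fspace set).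
        \<forall>f\<in>Hom A A'. \<forall>f'\<in>Hom A' A''. \<forall>g\<in>Hom B B'. \<forall>g'\<in>Hom B' B''.
          (f' \<circ>\<^sub>m f) \<otimes>\<^sub>m (g' \<circ>\<^sub>m g) = (f' \<otimes>\<^sub>m g') \<circ>\<^sub>m (f \<otimes>\<^sub>m g)) \<and>

     \<comment> \<open>the structural maps are natural isomorphisms\<close>
     (\<forall>A\<in>(FinSp :: 'a fspace set). \<forall>B\<in>(FinSp :: 'b fspace set). \<forall>C\<in>(FinSp :: 'c fspace set).
        assoc A B C \<in> Iso ((A \<otimes> B) \<otimes> C) (A \<otimes> (B \<otimes> C))) \<and>
     (\<forall>A\<in>(FinSp :: 'a fspace set).
        lunit A \<in> Iso (unit_sp \<otimes> A) A \<and> runit A \<in> Iso (A \<otimes> unit_sp) A) \<and>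
     (\<forall>A\<in>(FinSp :: 'a fspace set). \<forall>B\<in>(FinSp :: 'b fspace set).
        symm A B \<in> Iso (A \<otimes> B) (B \<otimes> A)) \<and>
     (\<forall>A\<in>(FinSp :: 'a fspace set). \<forall>B\<in>(FinSp :: 'b fspace set). \<forall>C\<in>(FinSp :: 'c fspace set).
      \<forall>A'\<in>(FinSp :: 'e fspace set). \<forall>B'\<in>(FinSp :: 'f fspace set). \<forall>C'\<in>(FinSp :: 'g fspace set).
        \<forall>f\<in>Hom A A'. \<forall>g\<in>Hom B B'. \<forall>h\<in>Hom C C'.
          assoc A' B' C' \<circ>\<^sub>m ((f \<otimes>\<^sub>m g) \<otimes>\<^sub>m h) = (f \<otimes>\<^sub>m (g \<otimes>\<^sub>m h)) \<circ>\<^sub>m assoc A B C) \<and>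
     (\<forall>A\<in>(FinSp :: 'a fspace set). \<forall>A'\<in>(FinSp :: 'e fspace set). \<forall>f\<in>Hom A A'.
        lunit A' \<circ>\<^sub>m (ident unit_sp \<otimes>\<^sub>m f) = f \<circ>\<^sub>m lunit A \<and>
        runit A' \<circ>\<^sub>m (f \<otimes>\<^sub>m ident unit_sp) = f \<circ>\<^sub>m runit A) \<and>
     (\<forall>A\<in>(FinSp :: 'a fspace set). \<forall>B\<in>(FinSp :: 'b fspace set).
      \<forall>A'\<in>(FinSp :: 'e fspace set). \<forall>B'\<in>(FinSp :: 'f fspace set).
        \<forall>f\<in>Hom A A'. \<forall>g\<in>Hom B B'.
          symm A' B' \<circ>\<^sub>m (f \<otimes>\<^sub>m g) = (g \<otimes>\<^sub>m f) \<circ>\<^sub>m symm A B) \<and>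

     \<comment> \<open>coherence: pentagon, triangle, hexagon, involutivity and unit law of the symmetry\<close>
     (\<forall>A\<in>(FinSp :: 'a fspace set). \<forall>B\<in>(FinSp :: 'b fspace set).
      \<forall>C\<in>(FinSp :: 'c fspace set). \<forall>D\<in>(FinSp :: 'd fspace set).
        assoc A B (C \<otimes> D) \<circ>\<^sub>m assoc (A \<otimes> B) C D =
        (ident A \<otimes>\<^sub>m assoc B C D) \<circ>\<^sub>m (assoc A (B \<otimes> C) D \<circ>\<^sub>m (assoc A B C \<otimes>\<^sub>m ident D))) \<and>
     (\<forall>A\<in>(FinSp :: 'a fspace set). \<forall>B\<in>(FinSp :: 'b fspace set).
        (ident A \<otimes>\<^sub>m lunit B) \<circ>\<^sub>m assoc A unit_sp B = runit A \<otimes>\<^sub>m ident B) \<and>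
     (\<forall>A\<in>(FinSp :: 'a fspace set). \<forall>B\<in>(FinSp :: 'b fspace set). \<forall>C\<in>(FinSp :: 'c fspace set).
        assoc B C A \<circ>\<^sub>m (symm A (B \<otimes> C) \<circ>\<^sub>m assoc A B C) =
        (ident B \<otimes>\<^sub>m symm A C) \<circ>\<^sub>m (assoc B A C \<circ>\<^sub>m (symm A B \<otimes>\<^sub>m ident C))) \<and>
     (\<forall>A\<in>(FinSp :: 'a fspace set). \<forall>B\<in>(FinSp :: 'b fspace set).
        symm B A \<circ>\<^sub>m symm A B = ident (A \<otimes> B)) \<and>
     (\<forall>A\<in>(FinSp :: 'a fspace set). lunit A \<circ>\<^sub>m symm A unit_sp = runit A) \<and>

     \<comment> \<open>closedness: for every X, ihom X is a functor, ...\<close>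
     (\<forall>X\<in>(FinSp :: 'x fspace set).
        (\<forall>Y\<in>(FinSp :: 'a fspace set).
           ihom X Y \<in> FinSp \<and> ihom_map X Y (ident Y) = ident (ihom X Y)) \<and>
        (\<forall>Y\<in>(FinSp :: 'a fspace set). \<forall>Y'\<in>(FinSp :: 'b fspace set). \<forall>k\<in>Hom Y Y'.
           ihom_map X Y k \<in> Hom (ihom X Y) (ihom X Y')) \<and>
        (\<forall>Y\<in>(FinSp :: 'a fspace set). \<forall>Y'\<in>(FinSp :: 'b fspace set). \<forall>Y''\<in>(FinSp :: 'c fspace set).
         \<forall>k\<in>Hom Y Y'. \<forall>k'\<in>Hom Y' Y''.
           ihom_map X Y (k' \<circ>\<^sub>m k) = ihom_map X Y' k' \<circ>\<^sub>m ihom_map X Y k) \<and>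
        \<comment> \<open>... and it is right adjoint to tensoring with X\<close>
        (\<forall>Z\<in>(FinSp :: 'd fspace set). \<forall>Y\<in>(FinSp :: 'a fspace set).
           bij_betw pcurry (Hom (Z \<otimes> X) Y) (Hom Z (ihom X Y))) \<and>
        (\<forall>Z\<in>(FinSp :: 'd fspace set). \<forall>Z'\<in>(FinSp :: 'e fspace set).
         \<forall>Y\<in>(FinSp :: 'a fspace set). \<forall>Y'\<in>(FinSp :: 'b fspace set).
         \<forall>f\<in>Hom (Z \<otimes> X) Y. \<forall>g\<in>Hom Z' Z. \<forall>k\<in>Hom Y Y'.
           pcurry (k \<circ>\<^sub>m (f \<circ>\<^sub>m (g \<otimes>\<^sub>m ident X))) = ihom_map X Y k \<circ>\<^sub>m (pcurry f \<circ>\<^sub>m g)))"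
  by (intro conjI ballI;
      (rule ident_in_Hom comp_in_Hom comp_ident ident_comp map_comp_assoc
        tensor_in_FinSp unit_in_FinSp tensor_map_in_Hom tensor_map_ident tensor_map_comp
        assoc_in_Iso lunit_in_Iso runit_in_Iso symm_in_Iso
        assoc_natural lunit_natural runit_natural symm_natural
        pentagon triangle hexagon symm_involutive lunit_symm
        ihom_in_FinSp ihom_map_ident ihom_map_in_Hom ihom_map_comp
        bij_betw_pcurry pcurry_natural; assumption))

end
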